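(* Let $L$ be an atomistic complete lattice with set $P$ of atoms and least element $0$. For $a\in L$ define $P_a:=\{p\in P\mid p\leq a\}$. There is a one-one correspondence between (i) lattice locality relations $\top_L$ on $L$ such that $0\,\top_L\,x$ for all $x\in L$ and such that for every $x\in L$ the set $x^{\top_L}$ admits a greatest element; and (ii) symmetric binary relations $\top_P$ on $P$ such that for any $p\in P$ there is a (unique) $a\in L$ such that $p^{\top_P}=P_a$. The correspondence is given by: $\top_P$ is the restriction of $\top_L$ to $P$; and $\top_L$ is defined in terms of $\top_P$ by: $a\,\top_L\,b$ if and only if either $a=0$ or $b=0$, or else $a\neq 0$, $b\neq 0$ and $p\,\top_P\,q$ for all $p,q\in P$ with $p\leq a$ and $q\leq b$.
   Context: An atom of a lattice $L$ with least element $0$ is an element that is minimal among the non-zero elements. $L$ is atomic if every non-zero element $a$ satisfies $p\leq a$ for some atom $p$. $L$ is atomistic if it is atomic and every element is a join of some finite set of atoms ($0$ being the join of the empty set). $L$ is complete if every subset has a supremum and an infimum. For a symmetric binary relation $\top$ on a set $X$ and $x\in X$, $x^\top:=\{y\in X\mid x\,\top\,y\}$. A poset ideal of $L$ is a subset $M$ with $a\in M$, $b\leq a\Rightarrow b\in M$; a lattice ideal is a poset ideal closed under $\vee$. A lattice locality relation on $L$ is a symmetric binary relation $\top$ on $L$ such that $a^\top$ is a lattice ideal of $L$ for every $a\in L$. *)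

theory Defs
  imports Main
begin

definition atoms :: "'a::order_bot set" where
  "atoms = {p. p \<noteq> bot \<and> (\<forall>x. x \<noteq> bot \<longrightarrow> x \<le> p \<longrightarrow> x = p)}"

definition atoms_below :: "'a::order_bot \<Rightarrow> 'a set" where
  "atoms_below a = {p \<in> atoms. p \<le> a}"

definition atomic :: "'a::order_bot itself \<Rightarrow> bool" where
  "atomic _ \<longleftrightarrow> (\<forall>a::'a. a \<noteq> bot \<longrightarrow> (\<exists>p\<in>atoms. p \<le> a))"

text \<open>Only joins of finitely many atoms are allowed here, even though all joins exist.\<close>

definition atomistic :: "'a::complete_lattice itself \<Rightarrow> bool" where
  "atomistic T \<longleftrightarrow>
     atomic T \<and> (\<forall>a::'a. \<exists>A. finite A \<and> A \<subseteq> atoms \<and> a = Sup A)"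

definition poset_ideal :: "'a::order set \<Rightarrow> bool" where
  "poset_ideal M \<longleftrightarrow> (\<forall>a\<in>M. \<forall>b. b \<le> a \<longrightarrow> b \<in> M)"

definition lattice_ideal :: "'a::lattice set \<Rightarrow> bool" where
  "lattice_ideal M \<longleftrightarrow> poset_ideal M \<and> (\<forall>a\<in>M. \<forall>b\<in>M. sup a b \<in> M)"

text \<open>A binary relation is a set of pairs \<open>R\<close>; the polar set of \<open>x\<close> is the image \<open>R `` {x}\<close>.\<close>

definition lattice_locality :: "'a::lattice rel \<Rightarrow> bool" where
  "lattice_locality R \<longleftrightarrow> sym R \<and> (\<forall>a. lattice_ideal (R `` {a}))"

definition has_greatest :: "'a::order set \<Rightarrow> bool" where
  "has_greatest M \<longleftrightarrow> (\<exists>m\<in>M. \<forall>y\<in>M. y \<le> m)"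

definition lattice_localities :: "'a::complete_lattice rel set" where
  "lattice_localities =
     {R. lattice_locality R \<and> (\<forall>x. (bot, x) \<in> R) \<and> (\<forall>x. has_greatest (R `` {x}))}"

text \<open>The condition \<open>S \<subseteq> atoms \<times> atoms\<close> makes \<open>S\<close> a relation on the set of atoms, so that
  equality of such relations is equality of sets of pairs.\<close>

definition atom_localities :: "'a::complete_lattice rel set" where
  "atom_localities =
     {S. S \<subseteq> atoms \<times> atoms \<and> sym S \<and> (\<forall>p\<in>atoms. \<exists>a. S `` {p} = atoms_below a)}"

definition restrict_to_atoms :: "'a::order_bot rel \<Rightarrow> 'a rel" where
  "restrict_to_atoms R = R \<inter> atoms \<times> atoms"

definition extend_from_atoms :: "'a::order_bot rel \<Rightarrow> 'a rel" where
  "extend_from_atoms S =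
     {(a, b). a = bot \<or> b = bot \<or>
        (a \<noteq> bot \<and> b \<noteq> bot \<and>
         (\<forall>p\<in>atoms. \<forall>q\<in>atoms. p \<le> a \<longrightarrow> q \<le> b \<longrightarrow> (p, q) \<in> S))}"

end

theory Submission
  imports Defs
begin

text \<open>
  In a complete lattice, the relations of kind (i) are exactly the symmetric relations all of whose
  polar sets are principal ideals \<open>{..m}\<close> (\<open>lattice_localities_iff\<close>): a lattice ideal with a
  greatest element \<open>m\<close> is \<open>{..m}\<close>. The relations of kind (ii) are the analogue for atoms: each
  polar set of an atom is the trace \<open>atoms_below a\<close> of a principal ideal. Since every element is
  the join of the atoms below it, a principal ideal and its trace determine each other, by
  \<open>b \<le> m \<longleftrightarrow> atoms_below b \<subseteq> atoms_below m\<close>.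

  Restricting a relation of kind (i) therefore gives one of kind (ii). Conversely, if the polar set
  of every atom \<open>p\<close> under \<open>S\<close> is the trace of \<open>{..g p}\<close>, then the polar set of \<open>a\<close> under the
  extension of \<open>S\<close> consists of the \<open>b\<close> with \<open>b \<le> g p\<close> for all atoms \<open>p \<le> a\<close>, and so it is
  \<open>{..m}\<close> with \<open>m\<close> the infimum of these \<open>g p\<close>. Completeness provides this infimum.
  That extending undoes restricting amounts to recovering \<open>a\<close> and \<open>b\<close> from their atoms, one
  argument at a time, inside polar sets that are principal ideals.
\<close>

lemma mem_atoms_below: "p \<in> atoms_below a \<longleftrightarrow> p \<in> atoms \<and> p \<le> a"
  by (simp add: atoms_below_def)

lemma atoms_below_bot: "atoms_below (bot :: 'a::order_bot) = {}"
  by (auto simp: atoms_below_def atoms_def bot_unique)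

lemma atoms_below_atom: "p \<in> atoms \<Longrightarrow> atoms_below p = {p}"
  by (auto simp: atoms_below_def atoms_def)

lemma atomistic_le_iff:
  fixes a b :: "'a::complete_lattice"
  assumes "atomistic TYPE('a)"
  shows "b \<le> a \<longleftrightarrow> atoms_below b \<subseteq> atoms_below a"
proof
  assume sub: "atoms_below b \<subseteq> atoms_below a"
  obtain A where A: "A \<subseteq> atoms" "b = Sup A"
    using assms unfolding atomistic_def by blast
  show "b \<le> a"
    unfolding A(2)
  proof (rule Sup_least)
    fix p assume "p \<in> A"
    then have "p \<in> atoms_below b"
      using A by (auto simp: mem_atoms_below intro: Sup_upper)
    then show "p \<le> a"
      using sub by (auto simp: mem_atoms_below)
  qed
qed (auto simp: mem_atoms_below)

lemma atomistic_atoms_below_inject: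
  fixes a b :: "'a::complete_lattice"
  assumes "atomistic TYPE('a)" and "atoms_below a = atoms_below b"
  shows "a = b"
proof (rule antisym)
  show "a \<le> b" "b \<le> a"
    using assms(2) by (simp_all add: atomistic_le_iff[OF assms(1)])
qed

lemma lattice_ideal_with_greatest_iff:
  fixes M :: "'a::lattice set"
  shows "lattice_ideal M \<and> has_greatest M \<longleftrightarrow> (\<exists>m. M = {..m})"
proof
  assume M: "lattice_ideal M \<and> has_greatest M"
  then obtain m where "m \<in> M" "\<forall>y\<in>M. y \<le> m"
    unfolding has_greatest_def by blast
  then have "M = {..m}"
    using M unfolding lattice_ideal_def poset_ideal_def by auto
  then show "\<exists>m. M = {..m}" ..
next
  assume "\<exists>m. M = {..m}"
  then obtain m where "M = {..m}" ..
  then show "lattice_ideal M \<and> has_greatest M"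
    unfolding lattice_ideal_def poset_ideal_def has_greatest_def by auto
qed

text \<open>The condition on \<open>bot\<close> is absorbed: \<open>bot\<close> lies in every principal ideal, hence in every
  polar set, and the relation is symmetric.\<close>

lemma lattice_localities_iff:
  "R \<in> lattice_localities \<longleftrightarrow> sym R \<and> (\<forall>x. \<exists>m. R `` {x} = {..m})"
proof -
  have principal: "(\<forall>x. lattice_ideal (R `` {x})) \<and> (\<forall>x. has_greatest (R `` {x}))
      \<longleftrightarrow> (\<forall>x. \<exists>m. R `` {x} = {..m})"
    unfolding all_conj_distrib[symmetric] lattice_ideal_with_greatest_iff by (rule refl)
  have bot: "\<forall>x. (bot, x) \<in> R" if "sym R" and polar: "\<forall>x. \<exists>m. R `` {x} = {..m}"
  proof
    fix x
    obtain m where "R `` {x} = {..m}"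
      using polar by blast
    then have "bot \<in> R `` {x}"
      by simp
    then show "(bot, x) \<in> R"
      using \<open>sym R\<close> by (auto dest: symD)
  qed
  have "R \<in> lattice_localities \<longleftrightarrow> sym R \<and> (\<forall>x. (bot, x) \<in> R)
      \<and> ((\<forall>x. lattice_ideal (R `` {x})) \<and> (\<forall>x. has_greatest (R `` {x})))"
    unfolding lattice_localities_def lattice_locality_def mem_Collect_eq by argo
  then show ?thesis
    unfolding principal using bot by argo
qed

text \<open>The clauses for \<open>bot\<close> become the vacuous case, as there are no atoms below \<open>bot\<close>.\<close>

lemma extend_from_atoms_iff:
  "(a, b) \<in> extend_from_atoms S \<longleftrightarrow> (\<forall>p\<in>atoms_below a. \<forall>q\<in>atoms_below b. (p, q) \<in> S)"
  by (cases "a = bot \<or> b = bot")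
    (auto simp: extend_from_atoms_def atoms_below_bot mem_atoms_below)

lemma restrict_in_atom_localities:
  assumes "R \<in> lattice_localities"
  shows "restrict_to_atoms R \<in> atom_localities"
proof -
  have "\<exists>a. restrict_to_atoms R `` {p} = atoms_below a" if "p \<in> atoms" for p
  proof -
    obtain m where "R `` {p} = {..m}"
      using assms by (auto simp: lattice_localities_iff)
    then have "restrict_to_atoms R `` {p} = atoms_below m"
      using that by (auto simp: restrict_to_atoms_def mem_atoms_below set_eq_iff)
    then show ?thesis ..
  qed
  moreover have "sym (restrict_to_atoms R)"
    using assms by (auto simp: lattice_localities_iff restrict_to_atoms_def sym_def)
  ultimately show ?thesis
    by (auto simp: atom_localities_def restrict_to_atoms_def)
qed

lemma extend_in_lattice_localities:
  fixes S :: "'a::complete_lattice rel"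
  assumes atomistic: "atomistic TYPE('a)" and S: "S \<in> atom_localities"
  shows "extend_from_atoms S \<in> lattice_localities"
proof -
  have "sym S"
    using S by (simp add: atom_localities_def)
  then have "sym (extend_from_atoms S)"
    by (auto simp: sym_def extend_from_atoms_iff)
  moreover have "\<exists>m. extend_from_atoms S `` {a} = {..m}" for a
  proof -
    have "\<forall>p\<in>atoms. \<exists>c. S `` {p} = atoms_below c"
      using S by (simp add: atom_localities_def)
    then obtain g where g: "\<forall>p\<in>atoms. S `` {p} = atoms_below (g p)"
      by (rule bchoice[THEN exE])
    have "(a, b) \<in> extend_from_atoms S \<longleftrightarrow> b \<le> (INF p\<in>atoms_below a. g p)" for b
    proof -
      have "(a, b) \<in> extend_from_atoms S \<longleftrightarrow> (\<forall>p\<in>atoms_below a. atoms_below b \<subseteq> S `` {p})"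
        by (auto simp: extend_from_atoms_iff)
      also have "\<dots> \<longleftrightarrow> (\<forall>p\<in>atoms_below a. atoms_below b \<subseteq> atoms_below (g p))"
        using g by (auto simp: mem_atoms_below)
      also have "\<dots> \<longleftrightarrow> b \<le> (INF p\<in>atoms_below a. g p)"
        by (simp add: le_INF_iff flip: atomistic_le_iff[OF atomistic])
      finally show ?thesis .
    qed
    then have "extend_from_atoms S `` {a} = {..(INF p\<in>atoms_below a. g p)}"
      by auto
    then show ?thesis ..
  qed
  ultimately show ?thesis
    by (simp add: lattice_localities_iff)
qed

lemma restrict_extend:
  assumes "S \<in> atom_localities"
  shows "restrict_to_atoms (extend_from_atoms S) = S"
  using assms
  by (auto simp: restrict_to_atoms_def extend_from_atoms_iff atoms_below_atom atom_localities_def)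

lemma extend_restrict:
  fixes R :: "'a::complete_lattice rel"
  assumes atomistic: "atomistic TYPE('a)" and R: "R \<in> lattice_localities"
  shows "extend_from_atoms (restrict_to_atoms R) = R"
proof -
  have sym: "(x, y) \<in> R \<longleftrightarrow> (y, x) \<in> R" for x y
    using R by (auto simp: lattice_localities_iff dest: symD)
  have polar: "(x, b) \<in> R \<longleftrightarrow> (\<forall>q\<in>atoms_below b. (x, q) \<in> R)" for x b
  proof -
    obtain m where "R `` {x} = {..m}"
      using R by (auto simp: lattice_localities_iff)
    then have "(x, y) \<in> R \<longleftrightarrow> y \<le> m" for y
      by (auto simp: set_eq_iff)
    then show ?thesis
      using atomistic_le_iff[OF atomistic, of b m] by (auto simp: mem_atoms_below)
  qed
  have "(a, b) \<in> extend_from_atoms (restrict_to_atoms R) \<longleftrightarrow> (a, b) \<in> R" for a b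
  proof -
    have "(a, b) \<in> extend_from_atoms (restrict_to_atoms R)
        \<longleftrightarrow> (\<forall>p\<in>atoms_below a. \<forall>q\<in>atoms_below b. (p, q) \<in> R)"
      by (auto simp: extend_from_atoms_iff restrict_to_atoms_def mem_atoms_below)
    also have "\<dots> \<longleftrightarrow> (\<forall>p\<in>atoms_below a. (b, p) \<in> R)"
      by (metis polar sym)
    also have "\<dots> \<longleftrightarrow> (a, b) \<in> R"
      by (metis polar sym)
    finally show ?thesis .
  qed
  then show ?thesis
    by auto
qed

theorem propositionA8:
  assumes "atomistic TYPE('a::complete_lattice)"
  shows "bij_betw restrict_to_atoms (lattice_localities :: 'a rel set) atom_localities
    \<and> bij_betw extend_from_atoms (atom_localities :: 'a rel set) lattice_localities
    \<and> (\<forall>R \<in> (lattice_localities :: 'a rel set). extend_from_atoms (restrict_to_atoms R) = R)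
    \<and> (\<forall>S \<in> (atom_localities :: 'a rel set). restrict_to_atoms (extend_from_atoms S) = S)
    \<and> (\<forall>S \<in> (atom_localities :: 'a rel set). \<forall>p\<in>atoms. \<exists>!a. S `` {p} = atoms_below a)"
proof (intro conjI)
  show inv1: "\<forall>R \<in> (lattice_localities :: 'a rel set). extend_from_atoms (restrict_to_atoms R) = R"
    using extend_restrict[OF assms] by blast
  show inv2: "\<forall>S \<in> (atom_localities :: 'a rel set). restrict_to_atoms (extend_from_atoms S) = S"
    using restrict_extend by blast
  have restrict: "restrict_to_atoms ` lattice_localities \<subseteq> (atom_localities :: 'a rel set)"
    using restrict_in_atom_localities by blast
  have extend: "extend_from_atoms ` atom_localities \<subseteq> (lattice_localities :: 'a rel set)"
    using extend_in_lattice_localities[OF assms] by blast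
  show "bij_betw restrict_to_atoms (lattice_localities :: 'a rel set) atom_localities"
    by (rule bij_betw_byWitness[OF inv1 inv2 restrict extend])
  show "bij_betw extend_from_atoms (atom_localities :: 'a rel set) lattice_localities"
    by (rule bij_betw_byWitness[OF inv2 inv1 extend restrict])
  show "\<forall>S \<in> (atom_localities :: 'a rel set). \<forall>p\<in>atoms. \<exists>!a. S `` {p} = atoms_below a"
  proof (intro ballI)
    fix S :: "'a rel" and p :: 'a
    assume "S \<in> atom_localities" "p \<in> atoms"
    then have "\<exists>a. S `` {p} = atoms_below a"
      by (simp add: atom_localities_def)
    then show "\<exists>!a. S `` {p} = atoms_below a"
      using atomistic_atoms_below_inject[OF assms] by blast
  qed
qed

end
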